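(* Let $\Omega_0,\Omega_1,\Omega_2>0$ and let $h_0,h_1,h_2$ be independent with $h_i\sim\mathcal{CN}(0,\Omega_i)$. For $N\in\{T_1,T_2,R\}$ let $\Gamma_N=\sum_{k=1}^{L_N}P_{I,N}|c_{N,k}|^2$ with $L_N\ge1$, $P_{I,N}>0$ fixed (not depending on $P$), $c_{N,k}\sim\mathcal{CN}(0,\Omega_{N,k})$, $\Omega_{N,k}>0$, all of $h_0,h_1,h_2,c_{N,k}$ mutually independent; let $\Gamma'_N=\mathbb E(\Gamma_N)$, $\Gamma''_N=\mathbb E(\Gamma_N^2)$. Let $\omega_1,\omega_2\in(0,1)$ with $\omega_1+\omega_2=1$. For $P>0$ set $\gamma_i=P|h_i|^2$, $\bar\gamma_i=P\Omega_i$ ($i=0,1,2$), and for $i\in\{1,2\}$, $j\in\{1,2\}\setminus\{i\}$, define $$\Upsilon_{T_i}=\frac{\gamma_0}{\Gamma_{T_i}+1}+\frac{\Upsilon_{T_i,1}\Upsilon_{T_i,2}}{\Upsilon_{T_i,1}+\Upsilon_{T_i,2}},\qquad \Upsilon_{T_i,1}=\frac{\gamma_i}{\Gamma_{T_i}+1},\ \Upsilon_{T_i,2}=\frac{\omega_j\gamma_j}{\Gamma_R+\omega_i\Gamma_{T_i}+\omega_i+1},$$ $F_{T_i}(\gamma)=\Pr(\Upsilon_{T_i}<\gamma)$, and, for constants $a,b>0$, the sum BER $$P^{\mathcal E}_{\rm sum}(P)=\sum_{i=1}^2 a\sqrt{\frac{b}{\pi}}\int_0^\infty F_{T_i}(\gamma)\frac{e^{-b\gamma}}{\sqrt\gamma}\,d\gamma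 .$$ Let $$P^{\mathcal O,{\rm Asy}}_{\rm pro}(\gamma_{th})=\sum_{i=1}^{2}\frac{\gamma_{th}^2}{2\bar\gamma_0}\left(\frac{\omega_i\left(\Gamma''_{T_i}+2\Gamma'_{T_i}+1\right)+\left(\Gamma'_R+1\right)\left(\Gamma'_{T_i}+1\right)}{\omega_j\bar\gamma_j}+\frac{\Gamma''_{T_i}+2\Gamma'_{T_i}+1}{\bar\gamma_i}\right)$$ (with $j$ the element of $\{1,2\}\setminus\{i\}$), and for any fixed $\gamma_{th}>0$ let $$P^{\mathcal E,{\rm Asy}}_{\rm sum}(P)=\frac{a}{\sqrt\pi\, b^2\gamma_{th}^2}G\!\left(\tfrac52\right)P^{\mathcal O,{\rm Asy}}_{\rm pro}(\gamma_{th}),$$ where $G$ is the gamma function (this quantity does not depend on $\gamma_{th}$). Then $P^{\mathcal E}_{\rm sum}(P)/P^{\mathcal E,{\rm Asy}}_{\rm sum}(P)\to1$ as $P\to\infty$.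
   Context: Model of a three-phase amplify-and-forward two-way relay network with co-channel interference: $P$ is the common transmit power of terminals and relay, $\Gamma_N$ the total interference power at node $N$, $\Upsilon_{T_i}$ the received SINR at terminal $T_i$. The constants $a,b$ depend on the modulation (e.g. $(a,b)=(0.5,1)$ for BPSK). *)

theory Defs
  imports "HOL-Probability.Probability"
begin

text \<open>Nodes of the network and indices of the random variables
  h_0, h_1, h_2 (H l) and c_{N,k} (C N k).\<close>
datatype node = T1 | T2 | R
datatype rv_idx = H nat | C node nat

definition CN_density :: "real \<Rightarrow> complex \<Rightarrow> ennreal" where
  "CN_density Om z = ennreal (exp (- (cmod z)\<^sup>2 / Om) / (pi * Om))"

definition valid_idx :: "(node \<Rightarrow> nat) \<Rightarrow> rv_idx set" where
  "valid_idx L = {H 0, H 1, H 2} \<union> {C N k | N k. 1 \<le> k \<and> k \<le> L N}"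

definition term_node :: "nat \<Rightarrow> node" where
  "term_node i = (if i = 1 then T1 else T2)"

definition other :: "nat \<Rightarrow> nat" where
  "other i = 3 - i"

definition interf :: "(node \<Rightarrow> nat) \<Rightarrow> (node \<Rightarrow> real) \<Rightarrow> (rv_idx \<Rightarrow> 'a \<Rightarrow> complex)
    \<Rightarrow> node \<Rightarrow> 'a \<Rightarrow> real" where
  "interf L PI X N w = (\<Sum>k = 1..L N. PI N * (cmod (X (C N k) w))\<^sup>2)"

definition sinr :: "(node \<Rightarrow> nat) \<Rightarrow> (node \<Rightarrow> real) \<Rightarrow> (rv_idx \<Rightarrow> 'a \<Rightarrow> complex)
    \<Rightarrow> (nat \<Rightarrow> real) \<Rightarrow> real \<Rightarrow> nat \<Rightarrow> 'a \<Rightarrow> real" where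
  "sinr L PI X wt P i w =
     (let G = (\<lambda>N. interf L PI X N w);
          g = (\<lambda>l. P * (cmod (X (H l) w))\<^sup>2);
          j = other i;
          u1 = g i / (G (term_node i) + 1);
          u2 = wt j * g j / (G R + wt i * G (term_node i) + wt i + 1)
      in g 0 / (G (term_node i) + 1) + u1 * u2 / (u1 + u2))"

definition ber_sum :: "'a measure \<Rightarrow> (node \<Rightarrow> nat) \<Rightarrow> (node \<Rightarrow> real) \<Rightarrow> (rv_idx \<Rightarrow> 'a \<Rightarrow> complex)
    \<Rightarrow> (nat \<Rightarrow> real) \<Rightarrow> real \<Rightarrow> real \<Rightarrow> real \<Rightarrow> real" where
  "ber_sum M L PI X wt a b P =
     (\<Sum>i\<in>{1,2}. a * sqrt (b / pi) *
        (LBINT \<gamma>:{0<..}. measure M {w \<in> space M. sinr L PI X wt P i w < \<gamma>}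
                          * exp (- b * \<gamma>) / sqrt \<gamma>))"

definition out_asy :: "'a measure \<Rightarrow> (node \<Rightarrow> nat) \<Rightarrow> (node \<Rightarrow> real) \<Rightarrow> (rv_idx \<Rightarrow> 'a \<Rightarrow> complex)
    \<Rightarrow> (nat \<Rightarrow> real) \<Rightarrow> (nat \<Rightarrow> real) \<Rightarrow> real \<Rightarrow> real \<Rightarrow> real" where
  "out_asy M L PI X Om wt gth P =
     (let G1 = (\<lambda>N. integral\<^sup>L M (interf L PI X N));
          G2 = (\<lambda>N. integral\<^sup>L M (\<lambda>w. (interf L PI X N w)\<^sup>2));
          gb = (\<lambda>l. P * Om l)
      in (\<Sum>i\<in>{1,2}. gth\<^sup>2 / (2 * gb 0) *
           ((wt i * (G2 (term_node i) + 2 * G1 (term_node i) + 1)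
              + (G1 R + 1) * (G1 (term_node i) + 1)) / (wt (other i) * gb (other i))
            + (G2 (term_node i) + 2 * G1 (term_node i) + 1) / gb i)))"

definition ber_asy :: "'a measure \<Rightarrow> (node \<Rightarrow> nat) \<Rightarrow> (node \<Rightarrow> real) \<Rightarrow> (rv_idx \<Rightarrow> 'a \<Rightarrow> complex)
    \<Rightarrow> (nat \<Rightarrow> real) \<Rightarrow> (nat \<Rightarrow> real) \<Rightarrow> real \<Rightarrow> real \<Rightarrow> real \<Rightarrow> real \<Rightarrow> real" where
  "ber_asy M L PI X Om wt a b gth P =
     a / (sqrt pi * b\<^sup>2 * gth\<^sup>2) * Gamma (5/2) * out_asy M L PI X Om wt gth P"

end

theory Submission
  imports Defs "HOL-Real_Asymp.Real_Asymp"
begin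

text \<open>
  Write \<open>S\<close> for the interference plus noise power at a terminal and \<open>Q\<close> for the power that divides
  the other fading gain. Given \<open>S\<close> and \<open>Q\<close>, the received SINR is
  \<open>P (A / S + par (B / S) (C / Q))\<close> with independent exponential \<open>A\<close>, \<open>B\<close>, \<open>C\<close> and
  \<open>par u v = u v / (u + v)\<close>. Since \<open>par u v\<close> is small exactly when \<open>u\<close> or \<open>v\<close> is, up to an event
  of second order, its distribution function near 0 is the sum of those of \<open>B / S\<close> and \<open>C / Q\<close>,
  hence linear; convolving with the density of \<open>A / S\<close> gives a function asymptotic to
  a constant times \<open>S (l1 S + l2 Q) e\<^sup>2 / 2\<close>. Both functions are bounded globally by a multiple of
  their leading term (\<open>l1\<close>, \<open>l2\<close> are the rates of \<open>B\<close>, \<open>C\<close>), so dominated convergence applies first to the average over the interference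
  and then to the integral over \<open>\<gamma>\<close>, which becomes a Gamma integral.
\<close>

section \<open>Squared modulus of a complex Gaussian variable\<close>

text \<open>The disc of squared radius \<open>a\<close> has area \<open>pi * a\<close>, which is
  linear in \<open>a\<close>, so squaring the modulus turns planar Lebesgue measure into a constant
  multiple of length on the half-line. Comparing the two measures on half-lines suffices, since
  these generate the Borel sets.\<close>

lemma distr_cmod_squared:
  "distr lborel borel (\<lambda>z::complex. (cmod z)\<^sup>2) = density lborel (\<lambda>x::real. ennreal pi * indicator {0..} x)"
proof (rule measure_eqI_generator_eq)
  let ?E = "range (\<lambda>a::real. {..a})"
  show "Int_stable ?E"
    by (auto simp: Int_stable_def)
  show "?E \<subseteq> Pow UNIV" by simp
  have lhs: "emeasure (distr lborel borel (\<lambda>z::complex. (cmod z)\<^sup>2)) {..a} = ennreal (pi * max a 0)" for a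
  proof -
    have eq: "(\<lambda>z::complex. (cmod z)\<^sup>2) -` {..a} \<inter> space lborel = (if a \<ge> 0 then cball 0 (sqrt a) else {})"
    proof (cases "a \<ge> 0")
      case True
      then have "(cmod z)\<^sup>2 \<le> a \<longleftrightarrow> cmod z \<le> sqrt a" for z
        using real_le_rsqrt real_sqrt_le_iff[of "(cmod z)\<^sup>2" a] by auto
      then show ?thesis using True by (auto simp: )
    next
      case False
      then have "\<not> (cmod z)\<^sup>2 \<le> a" for z
        using zero_le_power2[of "cmod z"] by linarith
      then show ?thesis using False by auto
    qed
    show ?thesis
      by (subst emeasure_distr, simp, simp, subst eq) (auto simp: emeasure_cball unit_ball_vol_2 max_def)
  qed
  have rhs: "emeasure (density lborel (\<lambda>x::real. ennreal pi * indicator {0..} x)) {..a} = ennreal (pi * max a 0)" for a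
  proof -
    have "emeasure (density lborel (\<lambda>x::real. ennreal pi * indicator {0..} x)) {..a} =
        (\<integral>\<^sup>+ x. ennreal pi * indicator {0..a} x \<partial>lborel)"
      by (subst emeasure_density) (auto intro!: nn_integral_cong split: split_indicator)
    also have "\<dots> = ennreal pi * emeasure lborel {0..a}"
      by (subst nn_integral_cmult_indicator) auto
    also have "\<dots> = ennreal (pi * max a 0)"
      by (auto simp: ennreal_mult' max_def emeasure_lborel_Icc_eq)
    finally show ?thesis .
  qed
  show "\<And>X. X \<in> ?E \<Longrightarrow> emeasure (distr lborel borel (\<lambda>z::complex. (cmod z)\<^sup>2)) X =
      emeasure (density lborel (\<lambda>x::real. ennreal pi * indicator {0..} x)) X"
    using lhs rhs by auto
  have "sets borel = sigma_sets UNIV ?E"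
    by (subst borel_eq_atMost) simp
  then show "sets (distr lborel borel (\<lambda>z::complex. (cmod z)\<^sup>2)) = sigma_sets UNIV ?E"
    "sets (density lborel (\<lambda>x::real. ennreal pi * indicator {0..} x)) = sigma_sets UNIV ?E"
    by simp_all
  show "range (\<lambda>n::nat. {..real n}) \<subseteq> ?E" by auto
  show "(\<Union>n::nat. {..real n}) = UNIV"
    by (auto simp: real_arch_simple)
  show "\<And>n::nat. emeasure (distr lborel borel (\<lambda>z::complex. (cmod z)\<^sup>2)) {..real n} \<noteq> \<infinity>"
    by (simp add: lhs)
qed

text \<open>The Gaussian density depends on \<open>z\<close> only through its squared modulus, so it
  can be carried along the image of Lebesgue measure. The factor \<open>pi\<close> from the disc
  area cancels the one in \<open>CN_density\<close>, which leaves an exponential law.\<close>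

lemma exponential_cmod_squared:
  assumes D: "distributed M lborel X (CN_density Om)" and Om: "Om > 0"
  shows "distributed M lborel (\<lambda>w. (cmod (X w))\<^sup>2) (exponential_density (1 / Om))"
proof -
  define g where "g x = ennreal (exp (- x / Om) / (pi * Om))" for x :: real
  have [measurable]: "g \<in> borel_measurable borel"
    unfolding g_def by measurable
  have X[measurable]: "X \<in> measurable M lborel"
    using D by (rule distributed_measurable)
  then have [measurable]: "X \<in> borel_measurable M" by simp
  have "distr M lborel (\<lambda>w. (cmod (X w))\<^sup>2) = distr (distr M lborel X) borel (\<lambda>z. (cmod z)\<^sup>2)"
    by (subst distr_distr) (auto simp: comp_def intro!: distr_cong)
  also have "\<dots> = distr (density lborel (\<lambda>z. g ((cmod z)\<^sup>2))) borel (\<lambda>z. (cmod z)\<^sup>2)"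
    by (simp add: distributed_distr_eq_density[OF D] CN_density_def[abs_def] g_def)
  also have "\<dots> = density (distr lborel borel (\<lambda>z::complex. (cmod z)\<^sup>2)) g"
    by (rule density_distr[symmetric]) auto
  also have "\<dots> = density lborel (\<lambda>x. (ennreal pi * indicator {0..} x) * g x)"
    unfolding distr_cmod_squared by (rule density_density_eq) auto
  also have "(\<lambda>x. (ennreal pi * indicator {0..} x) * g x) = exponential_density (1 / Om)"
    using Om by (auto simp: g_def exponential_density_def fun_eq_iff ennreal_mult'[symmetric] split: split_indicator)
  finally show ?thesis
    by (auto simp: distributed_def)
qed

section \<open>The parallel combination of two gains\<close>

text \<open>Half the harmonic mean. At \<open>u = v = 0\<close> division by zero gives 0, which is
  also the continuous extension from nonnegative arguments.\<close>

definition par :: "real \<Rightarrow> real \<Rightarrow> real" where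
  "par u v = u * v / (u + v)"

lemma par_nonneg: "u \<ge> 0 \<Longrightarrow> v \<ge> 0 \<Longrightarrow> par u v \<ge> 0"
  by (simp add: par_def)

lemma measurable_par [measurable]:
  assumes [measurable]: "f \<in> borel_measurable M" "g \<in> borel_measurable M"
  shows "(\<lambda>w. par (f w) (g w)) \<in> borel_measurable M"
  unfolding par_def by measurable

text \<open>If \<open>u \<le> x\<close>, then \<open>x * (u + v) - u * v\<close> is at least
  \<open>x * u\<close>, which is positive unless \<open>u = 0\<close>; in that case
  \<open>par u v\<close> is 0. This supplies the lower bound for the distribution function of
  \<open>par\<close>.\<close>

lemma par_less:
  assumes "u \<ge> 0" "v \<ge> 0" "x > 0" "u \<le> x \<or> v \<le> x"
  shows "par u v < x"
proof -
  have *: "par u v < x" if "u \<ge> 0" "v \<ge> 0" "u \<le> x" for u v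
  proof (cases "u + v = 0")
    case False
    then have pos: "u + v > 0" using that by linarith
    have "u * v < x * (u + v)"
    proof (cases "u = 0")
      case False
      then have "u * v \<le> x * v" "0 < x * u" using that assms(3) by (auto intro: mult_right_mono)
      then show ?thesis by (simp add: algebra_simps)
    qed (use pos assms(3) in auto)
    then show ?thesis using pos by (simp add: par_def pos_divide_less_eq)
  qed (use assms(3) in \<open>simp add: par_def\<close>)
  have "par u v = par v u" by (simp add: par_def ac_simps)
  then show ?thesis using *[of u v] *[of v u] assms by auto
qed

text \<open>For \<open>u + v > 0\<close>, \<open>par u v < x\<close> says that
  \<open>(u - x) * (v - x)\<close> is below \<open>x * x\<close>. This fails once one factor exceeds
  \<open>d * x\<close> and the other \<open>x / d\<close>. The event is thus covered by two
  one-variable events with slack \<open>d\<close> and a joint event whose probability will be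
  quadratic in \<open>x\<close>.\<close>

lemma par_lessD:
  assumes "u \<ge> 0" "v \<ge> 0" "x > 0" "d > 0" "par u v < x"
  shows "u \<le> (1 + d) * x \<or> v \<le> (1 + d) * x \<or> u \<le> (1 + 1 / d) * x \<and> v \<le> (1 + 1 / d) * x"
proof (rule ccontr)
  have *: "par u v \<ge> x" if u: "u > (1 + d) * x" and v: "v > (1 + 1 / d) * x" for u v
  proof -
    have "d * x \<le> u - x" "1 / d * x \<le> v - x" "0 \<le> d * x" "0 \<le> 1 / d * x"
      using u v assms(3,4) by (auto simp: algebra_simps)
    then have "(u - x) * (v - x) \<ge> (d * x) * (1 / d * x)"
      by (intro mult_mono) auto
    then have "u * v \<ge> x * (u + v)"
      using assms(4) by (simp add: algebra_simps)
    moreover have "u + v > 0"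
    proof -
      have "(1 + d) * x > 0" "(1 + 1 / d) * x > 0" using assms(3,4) by (auto intro!: mult_pos_pos add_pos_pos)
      then show ?thesis using u v by linarith
    qed
    ultimately show ?thesis by (simp add: par_def pos_le_divide_eq)
  qed
  assume "\<not> ?thesis"
  moreover have "par u v = par v u" by (simp add: par_def ac_simps)
  ultimately show False using *[of u v] *[of v u] assms(5) by (auto simp: not_le)
qed

section \<open>Exponential bounds and conditioning on an independent variable\<close>

context prob_space
begin

lemma exponential_prob_le:
  assumes "distributed M lborel X (exponential_density l)" "0 \<le> a" "0 < l"
  shows "prob {w \<in> space M. X w \<le> a} \<le> l * a"
  using exponential_distributedD_le[OF assms] exp_ge_add_one_self[of "- a * l"]
  by (simp add: ac_simps)

text \<open>Fubini for the joint law, which is a product measure by independence: the inner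
  probability is the measure of a section. Both probabilities live on \<open>M\<close>, with
  \<open>A\<close> frozen at \<open>w\<close> and \<open>B\<close> evaluated at a separate point
  \<open>w'\<close>.\<close>

lemma prob_indep_integral:
  assumes "indep_var N1 A N2 B" and Q: "{x \<in> space (N1 \<Otimes>\<^sub>M N2). Q (fst x) (snd x)} \<in> sets (N1 \<Otimes>\<^sub>M N2)"
  shows "(\<lambda>w. prob {w' \<in> space M. Q (A w) (B w')}) \<in> borel_measurable M"
    and "prob {w \<in> space M. Q (A w) (B w)} = (\<integral>w. prob {w' \<in> space M. Q (A w) (B w')} \<partial>M)"
proof -
  have A[measurable]: "A \<in> measurable M N1" and B[measurable]: "B \<in> measurable M N2"
    and eq: "distr M N1 A \<Otimes>\<^sub>M distr M N2 B = distr M (N1 \<Otimes>\<^sub>M N2) (\<lambda>x. (A x, B x))"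
    using assms(1) by (auto simp: indep_var_distribution_eq)
  interpret DB: prob_space "distr M N2 B" by (rule prob_space_distr) simp
  let ?S = "{x \<in> space (N1 \<Otimes>\<^sub>M N2). Q (fst x) (snd x)}"
  have cut: "prob {w' \<in> space M. Q a (B w')} = measure (distr M N2 B) (Pair a -` ?S)" if "a \<in> space N1" for a
    using that sets_Pair1[OF Q, of a]
    by (subst measure_distr[OF B]) (auto simp: space_pair_measure intro!: arg_cong[where f=prob]
      dest: measurable_space[OF B])
  have m: "(\<lambda>a. emeasure (distr M N2 B) (Pair a -` ?S)) \<in> borel_measurable N1"
    using DB.measurable_emeasure_Pair[of ?S N1] Q by simp
  then have m': "(\<lambda>a. measure (distr M N2 B) (Pair a -` ?S)) \<in> borel_measurable N1"
    unfolding measure_def by simp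
  show meas: "(\<lambda>w. prob {w' \<in> space M. Q (A w) (B w')}) \<in> borel_measurable M"
    using measurable_compose[OF A m'] by (rule measurable_cong[THEN iffD1, rotated])
      (simp add: cut measurable_space[OF A])
  have "emeasure M {w \<in> space M. Q (A w) (B w)} = emeasure (distr M (N1 \<Otimes>\<^sub>M N2) (\<lambda>x. (A x, B x))) ?S"
    using Q by (subst emeasure_distr) (auto simp: space_pair_measure intro!: arg_cong[where f="emeasure M"]
      dest: measurable_space[OF A] measurable_space[OF B])
  also have "\<dots> = (\<integral>\<^sup>+ a. emeasure (distr M N2 B) (Pair a -` ?S) \<partial>distr M N1 A)"
    unfolding eq[symmetric] by (rule DB.emeasure_pair_measure_alt) (use Q in simp)
  also have "\<dots> = (\<integral>\<^sup>+ w. emeasure (distr M N2 B) (Pair (A w) -` ?S) \<partial>M)"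
    using m by (subst nn_integral_distr) auto
  also have "\<dots> = (\<integral>\<^sup>+ w. ennreal (prob {w' \<in> space M. Q (A w) (B w')}) \<partial>M)"
    by (intro nn_integral_cong) (simp add: cut measurable_space[OF A] DB.emeasure_eq_measure)
  also have "\<dots> = ennreal (\<integral>w. prob {w' \<in> space M. Q (A w) (B w')} \<partial>M)"
    by (intro nn_integral_eq_integral integrable_const_bound[where B=1]) (auto simp: meas)
  finally show "prob {w \<in> space M. Q (A w) (B w)} = (\<integral>w. prob {w' \<in> space M. Q (A w) (B w')} \<partial>M)"
    by (simp add: emeasure_eq_measure)
qed

section \<open>Distribution function of \<open>par\<close> near 0\<close>

context
  fixes Y Z :: "'a \<Rightarrow> real" and l1 l2 p q :: real
  assumes ind: "indep_var borel Y borel Z"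
    and Y: "distributed M lborel Y (exponential_density l1)"
    and Z: "distributed M lborel Z (exponential_density l2)"
    and nonneg: "\<And>w. Y w \<ge> 0" "\<And>w. Z w \<ge> 0"
    and pos: "l1 > 0" "l2 > 0" "p > 0" "q > 0"
begin

private lemma rv_YZ: "Y \<in> borel_measurable M" "Z \<in> borel_measurable M"
  using ind by (auto dest: indep_var_rv1 indep_var_rv2)

private lemma scaled_le_iff:
  "prob {w \<in> space M. Y w / p \<le> x} = prob {w \<in> space M. Y w \<le> p * x}"
  "prob {w \<in> space M. Z w / q \<le> x} = prob {w \<in> space M. Z w \<le> q * x}"
  using pos by (simp_all add: pos_divide_le_eq mult.commute)

text \<open>With \<open>d = 1\<close> in \<open>par_lessD\<close> both slack factors are 2 and the
  joint event is absorbed by the other two. The factor 2 is not sharp, but the bound holds for all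
  \<open>x \<ge> 0\<close> and serves as domination later.\<close>

lemma prob_par_le:
  assumes x: "x \<ge> 0"
  shows "prob {w \<in> space M. par (Y w / p) (Z w / q) < x} \<le> 2 * (p * l1 + q * l2) * x"
proof (cases "x = 0")
  case True
  have "\<not> par (Y w / p) (Z w / q) < 0" for w
    using par_nonneg[of "Y w / p" "Z w / q"] nonneg pos by (simp add: not_less)
  then show ?thesis using True by simp
next
  case False
  with x have x: "x > 0" by simp
  note [measurable] = rv_YZ
  have "prob {w \<in> space M. par (Y w / p) (Z w / q) < x} \<le>
      prob ({w \<in> space M. Y w / p \<le> 2 * x} \<union> {w \<in> space M. Z w / q \<le> 2 * x})"
  proof (intro finite_measure_mono subsetI)
    fix w assume "w \<in> {w \<in> space M. par (Y w / p) (Z w / q) < x}"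
    then show "w \<in> {w \<in> space M. Y w / p \<le> 2 * x} \<union> {w \<in> space M. Z w / q \<le> 2 * x}"
      using par_lessD[of "Y w / p" "Z w / q" x 1] x nonneg pos by auto
  qed auto
  also have "\<dots> \<le> prob {w \<in> space M. Y w / p \<le> 2 * x} + prob {w \<in> space M. Z w / q \<le> 2 * x}"
    by (intro measure_Un_le) auto
  also have "\<dots> \<le> l1 * (p * (2 * x)) + l2 * (q * (2 * x))"
    unfolding scaled_le_iff using x pos by (intro add_mono exponential_prob_le Y Z) auto
  finally show ?thesis by (simp add: algebra_simps)
qed

text \<open>A union bound over the three events of \<open>par_lessD\<close>; independence factors
  the joint one, which makes it quadratic in \<open>x\<close>. The slack \<open>d\<close> stays free
  so that it can shrink together with \<open>x\<close>.\<close>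

private lemma prob_par_upper:
  assumes x: "x > 0" and d: "d > 0"
  shows "prob {w \<in> space M. par (Y w / p) (Z w / q) < x} \<le>
    (p * l1 + q * l2) * ((1 + d) * x) + (p * l1) * (q * l2) * ((1 + 1 / d) * x)\<^sup>2"
proof -
  note [measurable] = rv_YZ
  let ?k = "(1 + 1 / d) * x" and ?m = "(1 + d) * x"
  have kp: "?k \<ge> 0" "?m \<ge> 0" using x d by simp_all
  have "prob {w \<in> space M. par (Y w / p) (Z w / q) < x} \<le>
      prob (({w \<in> space M. Y w / p \<le> ?m} \<union> {w \<in> space M. Z w / q \<le> ?m}) \<union>
        {w \<in> space M. Y w / p \<in> {..?k} \<and> Z w / q \<in> {..?k}})"
  proof (intro finite_measure_mono subsetI)
    fix w assume "w \<in> {w \<in> space M. par (Y w / p) (Z w / q) < x}"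
    then show "w \<in> (({w \<in> space M. Y w / p \<le> ?m} \<union> {w \<in> space M. Z w / q \<le> ?m}) \<union>
        {w \<in> space M. Y w / p \<in> {..?k} \<and> Z w / q \<in> {..?k}})"
      using par_lessD[of "Y w / p" "Z w / q" x d] x d nonneg pos by auto
  qed auto
  also have "\<dots> \<le> (prob {w \<in> space M. Y w / p \<le> ?m} + prob {w \<in> space M. Z w / q \<le> ?m}) +
      prob {w \<in> space M. Y w / p \<in> {..?k} \<and> Z w / q \<in> {..?k}}"
    by (intro order_trans[OF measure_Un_le] add_mono measure_Un_le) auto
  also have "prob {w \<in> space M. Y w / p \<in> {..?k} \<and> Z w / q \<in> {..?k}} =
      prob {w \<in> space M. Y w \<in> {..p * ?k} \<and> Z w \<in> {..q * ?k}}"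
    using pos by (simp add: pos_divide_le_eq mult.commute)
  also have "\<dots> = prob {w \<in> space M. Y w \<le> p * ?k} * prob {w \<in> space M. Z w \<le> q * ?k}"
    using prob_indep_random_variable[OF ind, of "{..p * ?k}" "{..q * ?k}"] by simp
  also have "(prob {w \<in> space M. Y w / p \<le> ?m} + prob {w \<in> space M. Z w / q \<le> ?m}) +
      prob {w \<in> space M. Y w \<le> p * ?k} * prob {w \<in> space M. Z w \<le> q * ?k} \<le>
      (l1 * (p * ?m) + l2 * (q * ?m)) + (l1 * (p * ?k)) * (l2 * (q * ?k))"
    unfolding scaled_le_iff using pos kp
    by (intro add_mono mult_mono exponential_prob_le Y Z) (auto intro!: mult_nonneg_nonneg)
  finally show ?thesis by (simp add: algebra_simps power2_eq_square)
qed

text \<open>By \<open>par_less\<close> it is enough that one scaled gain is at most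
  \<open>x\<close>. The complement is an intersection of independent tail events, whose exponentials
  multiply.\<close>

private lemma prob_par_lower:
  assumes x: "x > 0"
  shows "1 - exp (- (p * l1 + q * l2) * x) \<le> prob {w \<in> space M. par (Y w / p) (Z w / q) < x}"
proof -
  note [measurable] = rv_YZ
  have "exp (- (p * l1 + q * l2) * x) = exp (- (p * x) * l1) * exp (- (q * x) * l2)"
    by (simp add: exp_add[symmetric] algebra_simps)
  also have "\<dots> = prob {w \<in> space M. p * x < Y w} * prob {w \<in> space M. q * x < Z w}"
    using x pos by (simp add: exponential_distributedD_gt[OF Y] exponential_distributedD_gt[OF Z])
  also have "\<dots> = prob {w \<in> space M. Y w \<in> {p * x<..} \<and> Z w \<in> {q * x<..}}"
    using prob_indep_random_variable[OF ind, of "{p * x<..}" "{q * x<..}"] by simp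
  also have "\<dots> = prob (space M - {w \<in> space M. Y w \<le> p * x \<or> Z w \<le> q * x})"
    by (intro arg_cong[where f=prob]) auto
  also have "\<dots> = 1 - prob {w \<in> space M. Y w \<le> p * x \<or> Z w \<le> q * x}"
    by (rule prob_compl) measurable
  finally have "exp (- (p * l1 + q * l2) * x) = 1 - prob {w \<in> space M. Y w \<le> p * x \<or> Z w \<le> q * x}" .
  moreover have "prob {w \<in> space M. Y w \<le> p * x \<or> Z w \<le> q * x} \<le>
      prob {w \<in> space M. par (Y w / p) (Z w / q) < x}"
  proof (intro finite_measure_mono subsetI)
    fix w assume "w \<in> {w \<in> space M. Y w \<le> p * x \<or> Z w \<le> q * x}"
    then show "w \<in> {w \<in> space M. par (Y w / p) (Z w / q) < x}"
      using par_less[of "Y w / p" "Z w / q" x] x nonneg pos by (auto simp: pos_divide_le_eq mult.commute)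
  qed measurable
  ultimately show ?thesis by linarith
qed

lemma prob_par_tendsto:
  "((\<lambda>x. prob {w \<in> space M. par (Y w / p) (Z w / q) < x} / x) \<longlongrightarrow> p * l1 + q * l2) (at_right 0)"
proof (rule tendsto_sandwich)
  \<comment> \<open>The choice \<open>d = x powr (1/3)\<close> makes both \<open>d\<close> and the relative size \<open>x / d\<^sup>2\<close> of the quadratic term vanish.\<close>
  define A B where "A = p * l1 + q * l2" and "B = (p * l1) * (q * l2)"
  have A: "A > 0" and B: "B > 0" using pos by (auto intro!: add_pos_pos mult_pos_pos simp: A_def B_def)
  show "\<forall>\<^sub>F x in at_right 0. (1 - exp (- A * x)) / x \<le> prob {w \<in> space M. par (Y w / p) (Z w / q) < x} / x"
    unfolding A_def by (rule eventually_at_rightI[of 0 1]) (intro divide_right_mono prob_par_lower, auto)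
  show "\<forall>\<^sub>F x in at_right 0. prob {w \<in> space M. par (Y w / p) (Z w / q) < x} / x \<le>
      (A * ((1 + x powr (1/3)) * x) + B * ((1 + 1 / x powr (1/3)) * x)\<^sup>2) / x"
    unfolding A_def B_def by (rule eventually_at_rightI[of 0 1]) (auto intro!: divide_right_mono prob_par_upper)
  show "((\<lambda>x. (1 - exp (- A * x)) / x) \<longlongrightarrow> p * l1 + q * l2) (at_right 0)"
    unfolding A_def[symmetric] using A by real_asymp
  show "((\<lambda>x. (A * ((1 + x powr (1/3)) * x) + B * ((1 + 1 / x powr (1/3)) * x)\<^sup>2) / x) \<longlongrightarrow> p * l1 + q * l2) (at_right 0)"
    unfolding A_def[symmetric] using A B by real_asymp
qed

end

section \<open>Adding the direct link\<close>

context
  fixes X U :: "'a \<Rightarrow> real" and l s B :: real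
  assumes ind: "indep_var borel X borel U"
    and X: "distributed M lborel X (exponential_density l)"
    and U_nonneg: "\<And>w. U w \<ge> 0" and X_nonneg: "\<And>w. X w \<ge> 0"
    and U_le: "\<And>x. x \<ge> 0 \<Longrightarrow> prob {w \<in> space M. U w < x} \<le> B * x"
    and pos: "l > 0" "s > 0" "B \<ge> 0"
begin

private lemma rv_XU: "X \<in> borel_measurable M" "U \<in> borel_measurable M"
  using ind by (auto dest: indep_var_rv1 indep_var_rv2)

text \<open>If a sum of nonnegative terms is below \<open>e\<close>, both terms are, and
  independence multiplies two linear bounds. The factor 1/2 of the true asymptotics is lost, but the
  bound is global in \<open>e\<close>.\<close>

lemma prob_add_le:
  assumes e: "e \<ge> 0"
  shows "prob {w \<in> space M. X w / s + U w < e} \<le> l * s * B * e\<^sup>2"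
proof -
  note [measurable] = rv_XU
  have "prob {w \<in> space M. X w / s + U w < e} \<le> prob {w \<in> space M. X w \<in> {..s * e} \<and> U w \<in> {..<e}}"
  proof (intro finite_measure_mono subsetI)
    fix w assume w: "w \<in> {w \<in> space M. X w / s + U w < e}"
    have "X w / s \<ge> 0" using X_nonneg pos by simp
    then have "X w / s \<le> e" "U w < e" using w U_nonneg[of w] by auto
    then show "w \<in> {w \<in> space M. X w \<in> {..s * e} \<and> U w \<in> {..<e}}"
      using w pos by (auto simp: pos_divide_le_eq mult.commute)
  qed measurable
  also have "\<dots> = prob {w \<in> space M. X w \<le> s * e} * prob {w \<in> space M. U w < e}"
    using prob_indep_random_variable[OF ind, of "{..s * e}" "{..<e}"] by simp
  also have "\<dots> \<le> (l * (s * e)) * (B * e)"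
    using e pos by (intro mult_mono exponential_prob_le X U_le) auto
  finally show ?thesis by (simp add: power2_eq_square ac_simps)
qed

private lemma U_cdf_nonpos: "y \<le> 0 \<Longrightarrow> prob {w \<in> space M. U w < y} = 0"
proof -
  assume "y \<le> 0"
  then have "\<not> U w < y" for w using U_nonneg[of w] by linarith
  then show ?thesis by simp
qed

private lemma U_cdf_measurable: "(\<lambda>y. prob {w \<in> space M. U w < y}) \<in> borel_measurable borel"
  using rv_XU by (intro borel_measurable_mono monoI finite_measure_mono) auto

text \<open>Conditioning on \<open>X\<close> gives a convolution of its density with the
  distribution function of \<open>U\<close>. After rescaling to the unit interval the density tends
  to \<open>l\<close> and the distribution function behaves like \<open>c * e * (1 - u)\<close>; the
  factor 1/2 is the integral of \<open>1 - u\<close>.\<close>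

lemma prob_add_tendsto:
  assumes lim: "((\<lambda>x. prob {w \<in> space M. U w < x} / x) \<longlongrightarrow> c) (at_right 0)"
  shows "((\<lambda>e. prob {w \<in> space M. X w / s + U w < e} / e\<^sup>2) \<longlongrightarrow> l * s * c / 2) (at_right 0)"
proof -
  note [measurable] = rv_XU
  define G where "G y = prob {w \<in> space M. U w < y}" for y
  have [measurable]: "G \<in> borel_measurable borel"
    using U_cdf_measurable by (simp add: G_def[abs_def])
  \<comment> \<open>Here \<open>e = inverse t\<close>, so that dominated convergence can be used at
    \<open>at_top\<close>, and \<open>u\<close> is the share of \<open>e\<close> taken by the direct
    link, \<open>x = inverse t * s * u\<close>. The Jacobian cancels one of the two factors
    \<open>t\<close> from division by the square of \<open>e\<close>; the other normalises
    \<open>G\<close>.\<close>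
  define f where "f t u = s * (exponential_density l (inverse t * s * u) * (G (inverse t * (1 - u)) * t))" for t u :: real
  have eq: "prob {w \<in> space M. X w / s + U w < inverse t} / (inverse t)\<^sup>2 = (\<integral>u. f t u \<partial>lborel)" if t: "t > 0" for t
  proof -
    have "prob {w \<in> space M. X w / s + U w < inverse t} =
        (\<integral>w. prob {w' \<in> space M. X w / s + U w' < inverse t} \<partial>M)"
      by (rule prob_indep_integral(2)[OF ind, where Q="\<lambda>x h. x / s + h < inverse t"]) measurable
    also have "\<dots> = (\<integral>w. G (inverse t - X w / s) \<partial>M)"
      by (simp add: G_def less_diff_eq add.commute)
    also have "\<dots> = (\<integral>x. exponential_density l x * G (inverse t - x / s) \<partial>lborel)"
      using pos by (intro distributed_integral[OF X, symmetric]) (auto simp: exponential_density_nonneg)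
    also have "\<dots> = inverse t * s * (\<integral>u. exponential_density l (inverse t * s * u) * G (inverse t * (1 - u)) \<partial>lborel)"
      using t pos by (subst lborel_integral_real_affine[where c="inverse t * s" and t=0])
        (auto simp: algebra_simps)
    finally show ?thesis
      using t by (simp add: f_def power2_eq_square field_simps)
  qed
  \<comment> \<open>For \<open>t > 0\<close> the integrand vanishes off the unit interval: the
    density is 0 for \<open>u < 0\<close>, and \<open>G\<close> has a nonpositive argument for
    \<open>u \<ge> 1\<close>.\<close>
  have "((\<lambda>t. \<integral>u. f t u \<partial>lborel) \<longlongrightarrow> (\<integral>u. indicator {0..1} u * (l * s * c * (1 - u)) \<partial>lborel)) at_top"
  proof (rule integral_dominated_convergence_at_top)
    show "(\<lambda>u. indicator {0..1} u * (l * s * c * (1 - u))) \<in> borel_measurable lborel"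
      by measurable
    show "f t \<in> borel_measurable lborel" for t
      unfolding f_def erlang_density_def by measurable
    show "integrable lborel (\<lambda>u. l * s * B * indicator {0..1::real} u)"
      by simp
    show "\<forall>\<^sub>F t in at_top. AE u in lborel. norm (f t u) \<le> l * s * B * indicator {0..1::real} u"
      using eventually_gt_at_top[of 0]
    proof eventually_elim
      case t: (elim t)
      have "norm (f t u) \<le> l * s * B * indicator {0..1::real} u" for u
      proof (cases "u \<in> {0..1}")
        case True
        have "exponential_density l (inverse t * s * u) \<le> l"
          using True t pos by (auto simp: exponential_density_def)
        moreover have "G (inverse t * (1 - u)) * t \<le> B"
        proof -
          have "G (inverse t * (1 - u)) \<le> B * (inverse t * (1 - u))"
            unfolding G_def using True t by (intro U_le) auto
          also have "\<dots> \<le> B * (inverse t * 1)"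
            using True t pos by (intro mult_left_mono) auto
          finally show ?thesis using t by (simp add: field_simps)
        qed
        moreover have "0 \<le> G (inverse t * (1 - u)) * t" using t by (simp add: G_def)
        ultimately have "f t u \<le> s * (l * B)" "f t u \<ge> 0"
          unfolding f_def using pos exponential_density_nonneg[of l]
          by (auto intro!: mult_left_mono mult_mono)
        then show ?thesis using True by (simp add: ac_simps)
      next
        case False
        have "f t u = 0"
        proof (cases "u < 0")
          case True
          then have "inverse t * s * u < 0" using t pos by (simp add: mult_pos_neg)
          then show ?thesis by (simp add: f_def exponential_density_def)
        next
          case False
          with \<open>u \<notin> {0..1}\<close> have "inverse t * (1 - u) \<le> 0" using t by (simp add: mult_nonneg_nonpos)
          then show ?thesis by (simp add: f_def G_def U_cdf_nonpos)
        qed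
        then show ?thesis using False by simp
      qed
      then show ?case by simp
    qed
    \<comment> \<open>The endpoint \<open>u = 1\<close> belongs to the degenerate case: the argument
      of \<open>G\<close> is then exactly 0, so the limit from the right says nothing, but
      \<open>f t u\<close> and the claimed limit are both 0.\<close>
    have "((\<lambda>t. f t u) \<longlongrightarrow> indicator {0..1} u * (l * s * c * (1 - u))) at_top" for u
    proof (cases "0 \<le> u \<and> u < 1")
      case True
      have 1: "((\<lambda>t. exponential_density l (inverse t * s * u)) \<longlongrightarrow> l) at_top"
      proof -
        have "((\<lambda>t. l * exp (- (inverse t * s * u) * l)) \<longlongrightarrow> l * exp (- (0 * s * u) * l)) at_top"
          by (intro tendsto_intros tendsto_inverse_0_at_top filterlim_ident)
        moreover have "\<forall>\<^sub>F t in at_top. l * exp (- (inverse t * s * u) * l) = exponential_density l (inverse t * s * u)"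
          using eventually_gt_at_top[of 0]
        proof eventually_elim
          case (elim t)
          then have "inverse t * s * u \<ge> 0" using True pos by simp
          then show ?case by (simp add: exponential_density_def)
        qed
        ultimately show ?thesis by (auto dest: Lim_transform_eventually)
      qed
      have "filterlim (\<lambda>t. inverse t * (1 - u)) (at_right 0) at_top"
        using True by real_asymp
      from filterlim_compose[OF lim this]
      have "((\<lambda>t. G (inverse t * (1 - u)) / (inverse t * (1 - u)) * (1 - u)) \<longlongrightarrow> c * (1 - u)) at_top"
        unfolding G_def by (intro tendsto_intros)
      moreover have "\<forall>\<^sub>F t in at_top. G (inverse t * (1 - u)) / (inverse t * (1 - u)) * (1 - u) = G (inverse t * (1 - u)) * t"
        using eventually_gt_at_top[of 0] by eventually_elim (use True in \<open>simp add: field_simps\<close>)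
      ultimately have 2: "((\<lambda>t. G (inverse t * (1 - u)) * t) \<longlongrightarrow> c * (1 - u)) at_top"
        by (rule Lim_transform_eventually)
      have "((\<lambda>t. f t u) \<longlongrightarrow> s * (l * (c * (1 - u)))) at_top"
        unfolding f_def by (intro tendsto_intros 1 2)
      then show ?thesis using True by (simp add: ac_simps)
    next
      case False
      have "\<forall>\<^sub>F t in at_top. f t u = 0"
        using eventually_gt_at_top[of 0]
      proof eventually_elim
        case t: (elim t)
        show ?case
        proof (cases "u < 0")
          case True
          then have "inverse t * s * u < 0" using t pos by (simp add: mult_pos_neg)
          then show ?thesis by (simp add: f_def exponential_density_def)
        next
          case False
          with \<open>\<not> (0 \<le> u \<and> u < 1)\<close> have "inverse t * (1 - u) \<le> 0" using t by (simp add: mult_nonneg_nonpos)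
          then show ?thesis by (simp add: f_def G_def U_cdf_nonpos)
        qed
      qed
      moreover have "indicator {0..1} u * (l * s * c * (1 - u)) = 0"
        using False by (auto split: split_indicator)
      ultimately show ?thesis by (simp only: tendsto_eventually)
    qed
    then show "AE u in lborel. ((\<lambda>t. f t u) \<longlongrightarrow> indicator {0..1} u * (l * s * c * (1 - u))) at_top"
      by simp
  qed
  also have "(\<integral>u. indicator {0..1} u * (l * s * c * (1 - u)) \<partial>lborel) = l * s * c / 2"
  proof -
    have "has_bochner_integral lborel (\<lambda>u. (l * s * c * (1 - u)) * indicator {0..1} u)
        (l * s * c * (1 - 1\<^sup>2 / 2) - l * s * c * (0 - 0\<^sup>2 / 2))"
      by (rule has_bochner_integral_FTC_Icc_real[where F="\<lambda>u. l * s * c * (u - u\<^sup>2 / 2)"])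
        (auto intro!: derivative_eq_intros simp: algebra_simps)
    then show ?thesis by (simp add: has_bochner_integral_iff mult.commute)
  qed
  finally have "((\<lambda>t. \<integral>u. f t u \<partial>lborel) \<longlongrightarrow> l * s * c / 2) at_top" .
  moreover have "\<forall>\<^sub>F t in at_top. (\<integral>u. f t u \<partial>lborel) =
      prob {w \<in> space M. X w / s + U w < inverse t} / (inverse t)\<^sup>2"
    using eventually_gt_at_top[of 0] by eventually_elim (simp only: eq)
  ultimately have "((\<lambda>t. prob {w \<in> space M. X w / s + U w < inverse t} / (inverse t)\<^sup>2) \<longlongrightarrow> l * s * c / 2) at_top"
    by (rule Lim_transform_eventually)
  then show ?thesis by (simp only: filterlim_at_right_to_top)
qed

end

end

section \<open>Averaging over the interference\<close>

lemma (in prob_space) indep_vars_pair: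
  assumes "indep_vars M' X I" "i \<in> I" "j \<in> I" "i \<noteq> j"
  shows "indep_var (M' i) (X i) (M' j) (X j)"
  using indep_var_compose[OF indep_var_restrict[OF assms(1), of "{i}" "{j}"],
      of "\<lambda>f. f i" "M' i" "\<lambda>f. f j" "M' j"] assms(2-)
  by (simp add: comp_def)

text \<open>
  \<open>V 0\<close> is the gain of the direct link, \<open>V 1\<close> and \<open>V 2\<close> are those of the two hops, and \<open>V 3\<close> and
  \<open>V 4\<close> the interference at the terminal and at the relay; \<open>a\<close> and \<open>c\<close> are the power fractions
  \<open>\<omega>\<^sub>i\<close> and \<open>\<omega>\<^sub>j\<close>.
\<close>

lemma (in prob_space) outage_asymptotics:
  fixes V :: "nat \<Rightarrow> 'a \<Rightarrow> real"
  assumes ind: "indep_vars (\<lambda>_. borel) V {..<5}"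
    and X: "distributed M lborel (V 0) (exponential_density l0)"
    and Y: "distributed M lborel (V 1) (exponential_density l1)"
    and Z: "distributed M lborel (V 2) (exponential_density l2)"
    and nonneg: "\<And>k w. V k w \<ge> 0"
    and pos: "l0 > 0" "l1 > 0" "l2 > 0" "a > 0" "c > 0"
    and int: "integrable M (V 3)" "integrable M (\<lambda>w. (V 3 w)\<^sup>2)" "integrable M (V 4)"
  defines "S \<equiv> \<lambda>w. V 3 w + 1" and "Q \<equiv> \<lambda>w. (V 4 w + a * V 3 w + a + 1) / c"
  defines "D \<equiv> \<lambda>e. prob {w \<in> space M. V 0 w / S w + par (V 1 w / S w) (V 2 w / Q w) < e}"
    and "m \<equiv> expectation (\<lambda>w. (V 3 w)\<^sup>2) + 2 * expectation (V 3) + 1"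
  defines "K \<equiv> l0 * (l1 * m + l2 * (a * m + (expectation (V 4) + 1) * (expectation (V 3) + 1)) / c)"
  shows "((\<lambda>e. D e / e\<^sup>2) \<longlongrightarrow> K / 2) (at_right 0)"
    and "e \<ge> 0 \<Longrightarrow> D e \<le> 2 * K * e\<^sup>2"
    and "K > 0"
proof -
  have SQ_pos: "S w > 0" "Q w > 0" for w
    using nonneg[of 3 w] nonneg[of 4 w] pos
    by (auto simp: S_def Q_def intro!: divide_pos_pos add_nonneg_pos add_nonneg_nonneg)
  have rv[measurable]: "V k \<in> borel_measurable M" if "k < 5" for k
    using ind that by (auto simp: indep_vars_def)
  define phi where "phi w e = prob {w' \<in> space M. V 0 w' / S w + par (V 1 w' / S w) (V 2 w' / Q w) < e}" for w e
  \<comment> \<open>One integrable function plays two roles: \<open>B w / 2\<close> is the limit of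
    \<open>phi w e / e\<^sup>2\<close>, and \<open>2 * B w\<close> dominates it.\<close>
  define B where "B w = l0 * S w * (l1 * S w + l2 * Q w)" for w
  have B_pos: "B w > 0" for w
    unfolding B_def using SQ_pos[of w] pos by (intro mult_pos_pos add_pos_pos) auto
  have B_int: "integrable M B" and B_eq: "(\<integral>w. B w \<partial>M) = K"
  proof -
    \<comment> \<open>The numerator of \<open>Q\<close> is \<open>a * S w + (V 4 w + 1)\<close>, so
      \<open>B\<close> splits into a multiple of the square of \<open>S\<close> and a multiple of
      \<open>(V 4 w + 1) * (V 3 w + 1)\<close>. Independence of \<open>V 3\<close> and
      \<open>V 4\<close> makes the mixed product integrable and factors its expectation.\<close>
    have B: "B w = l0 * (l1 + l2 * a / c) * ((V 3 w)\<^sup>2 + 2 * V 3 w + 1) + l0 * l2 / c * (V 4 w * V 3 w + V 4 w + V 3 w + 1)" for w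
      using pos by (simp add: B_def S_def Q_def power2_eq_square field_simps)
    have ind34: "indep_var borel (V 4) borel (V 3)"
      using indep_vars_pair[OF ind, of 4 3] by simp
    note int34 = indep_var_integrable[OF ind34 int(3) int(1)] indep_var_lebesgue_integral[OF ind34 int(3) int(1)]
    show "integrable M B" unfolding B using int int34 by simp
    have "(\<integral>w. B w \<partial>M) = l0 * (l1 + l2 * a / c) * m +
        l0 * l2 / c * (expectation (V 4) * expectation (V 3) + expectation (V 4) + expectation (V 3) + 1)"
      unfolding B m_def using int int34 by (simp add: prob_space)
    also have "\<dots> = K"
      using pos by (simp add: K_def field_simps)
    finally show "(\<integral>w. B w \<partial>M) = K" .
  qed
  have D_eq: "D e = (\<integral>w. phi w e \<partial>M)" and phi_meas[measurable]: "(\<lambda>w. phi w e) \<in> borel_measurable M" for e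
  proof -
    \<comment> \<open>\<open>f\<close> carries the interference block 3, 4 and \<open>g\<close> the
      gains 0, 1, 2. The blocks are independent, so the interference can be frozen while the gains
      are integrated out.\<close>
    define E where "E f g \<longleftrightarrow> g 0 / (f 3 + 1) + par (g 1 / (f 3 + 1)) (g 2 / ((f 4 + a * f 3 + a + 1) / c)) < e"
      for f g :: "nat \<Rightarrow> real"
    have ind': "indep_var (PiM {3, 4} (\<lambda>_. borel)) (\<lambda>w. restrict (\<lambda>k. V k w) {3, 4})
        (PiM {0, 1, 2} (\<lambda>_. borel)) (\<lambda>w. restrict (\<lambda>k. V k w) {0, 1, 2})"
      by (rule indep_var_restrict[OF ind]) auto
    have E: "{x \<in> space (PiM {3, 4} (\<lambda>_. borel) \<Otimes>\<^sub>M PiM {0, 1, 2} (\<lambda>_. borel)). E (fst x) (snd x)}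
        \<in> sets (PiM {3, 4} (\<lambda>_. borel) \<Otimes>\<^sub>M PiM {0, 1, 2} (\<lambda>_. borel))"
      unfolding E_def by measurable
    have "E (restrict (\<lambda>k. V k w) {3, 4}) (restrict (\<lambda>k. V k w') {0, 1, 2}) \<longleftrightarrow>
        V 0 w' / S w + par (V 1 w' / S w) (V 2 w' / Q w) < e" for w w'
      by (simp add: E_def S_def Q_def)
    with prob_indep_integral[OF ind' E]
    show "D e = (\<integral>w. phi w e \<partial>M)" "(\<lambda>w. phi w e) \<in> borel_measurable M"
      by (simp_all only: D_def phi_def)
  qed
  have ind_YZ: "indep_var borel (V 1) borel (V 2)"
    using indep_vars_pair[OF ind, of 1 2] by simp
  have ind_XU: "indep_var borel (V 0) borel (\<lambda>w. par (V 1 w / s) (V 2 w / q))" for s q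
  proof -
    have "(\<lambda>f. par (f 1 / s) (f 2 / q)) \<in> PiM {1, 2::nat} (\<lambda>_. borel) \<rightarrow>\<^sub>M borel"
      by measurable
    then show ?thesis
      using indep_var_compose[OF indep_var_restrict[OF ind, of "{0}" "{1, 2}"], of "\<lambda>f. f 0" borel
        "\<lambda>f. par (f 1 / s) (f 2 / q)" borel]
      by (simp add: comp_def)
  qed
  have par_ge: "par (V 1 w / s) (V 2 w / q) \<ge> 0" if "s > 0" "q > 0" for w s q
    using that nonneg by (intro par_nonneg) auto
  have cdf_le: "prob {w \<in> space M. par (V 1 w / s) (V 2 w / q) < x} \<le> (2 * (s * l1 + q * l2)) * x"
    if "s > 0" "q > 0" "x \<ge> 0" for s q x
    using that nonneg pos by (intro prob_par_le ind_YZ Y Z)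
  have phi_le: "phi w e \<le> 2 * B w * e\<^sup>2" if "e \<ge> 0" for w e
  proof -
    have "phi w e \<le> l0 * S w * (2 * (S w * l1 + Q w * l2)) * e\<^sup>2"
      unfolding phi_def using SQ_pos[of w] nonneg pos that
      by (intro prob_add_le ind_XU X par_ge cdf_le) auto
    then show ?thesis by (simp add: B_def algebra_simps)
  qed
  have phi_lim: "((\<lambda>e. phi w e / e\<^sup>2) \<longlongrightarrow> B w / 2) (at_right 0)" for w
  proof -
    have "((\<lambda>e. phi w e / e\<^sup>2) \<longlongrightarrow> l0 * S w * (S w * l1 + Q w * l2) / 2) (at_right 0)"
      unfolding phi_def using SQ_pos[of w] nonneg pos
      by (intro prob_add_tendsto[where B="2 * (S w * l1 + Q w * l2)"] prob_par_tendsto ind_YZ Y Z ind_XU X par_ge cdf_le) auto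
    then show ?thesis by (simp add: B_def algebra_simps)
  qed
  show "D e \<le> 2 * K * e\<^sup>2" if "e \<ge> 0" for e
  proof -
    have "integrable M (\<lambda>w. phi w e)"
      by (rule integrable_const_bound[where B=1]) (simp add: phi_def, rule phi_meas)
    then have "D e \<le> (\<integral>w. 2 * B w * e\<^sup>2 \<partial>M)"
      unfolding D_eq using phi_le[OF that] B_int by (intro integral_mono) auto
    then show ?thesis by (simp add: B_eq)
  qed
  have "((\<lambda>t. \<integral>w. phi w (inverse t) / (inverse t)\<^sup>2 \<partial>M) \<longlongrightarrow> (\<integral>w. B w / 2 \<partial>M)) at_top"
  proof (rule integral_dominated_convergence_at_top)
    show "(\<lambda>w. B w / 2) \<in> borel_measurable M" using B_int by auto
    show "integrable M (\<lambda>w. 2 * B w)" using B_int by simp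
    show "\<forall>\<^sub>F t in at_top. AE w in M. norm (phi w (inverse t) / (inverse t)\<^sup>2) \<le> 2 * B w"
      using eventually_gt_at_top[of 0]
    proof eventually_elim
      case (elim t)
      have "0 \<le> phi w (inverse t)" for w by (simp add: phi_def)
      then show ?case using elim phi_le[of "inverse t"] by (simp add: pos_divide_le_eq)
    qed
    show "AE w in M. ((\<lambda>t. phi w (inverse t) / (inverse t)\<^sup>2) \<longlongrightarrow> B w / 2) at_top"
      using phi_lim by (simp add: filterlim_at_right_to_top)
  qed measurable
  then show "((\<lambda>e. D e / e\<^sup>2) \<longlongrightarrow> K / 2) (at_right 0)"
    by (simp add: filterlim_at_right_to_top D_eq B_eq)
  show "K > 0"
  proof -
    \<comment> \<open>\<open>K\<close> is the integral of a strictly positive function; if it were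
      0, \<open>B\<close> would vanish almost everywhere, which is impossible on a probability
      space.\<close>
    have "K \<noteq> 0"
      unfolding B_eq[symmetric]
    proof
      assume "(\<integral>w. B w \<partial>M) = 0"
      then have "AE w in M. B w = 0"
        using B_int B_pos by (subst (asm) integral_nonneg_eq_0_iff_AE) (auto intro: less_imp_le)
      then have "AE w in M. False"
        using B_pos by (auto simp: less_le)
      then show False by simp
    qed
    moreover have "K \<ge> 0"
      unfolding B_eq[symmetric] using B_pos by (intro Bochner_Integration.integral_nonneg) (auto intro: less_imp_le)
    ultimately show ?thesis by simp
  qed
qed

section \<open>Integration over the SINR threshold\<close>

lemma has_bochner_integral_Gamma_5_2:
  assumes "b > 0"
  shows "has_bochner_integral lborel (\<lambda>t::real. indicator {0<..} t * (t\<^sup>2 * exp (- b * t) / sqrt t))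
    (Gamma (5/2) / (b\<^sup>2 * sqrt b))"
proof -
  define g :: "real \<Rightarrow> real" where "g t = indicator {0..} t * t powr (5/2 - 1) / exp t" for t
  have "has_bochner_integral lborel g (Gamma (5/2))"
    unfolding g_def by (rule has_bochner_integral_nn_integral)
      (use Gamma_conv_nn_integral_real[of "5/2"] in \<open>auto simp: less_imp_le\<close>)
  then have "has_bochner_integral lborel (\<lambda>t. g (0 + b * t)) (Gamma (5/2) /\<^sub>R \<bar>b\<bar>)"
    using assms by (subst (asm) lborel_has_bochner_integral_real_affine_iff[of b _ _ 0]) auto
  \<comment> \<open>The substitution leaves \<open>(b * t) powr (3/2)\<close>, and this factor
    removes its constant \<open>b * sqrt b\<close>; with the Jacobian \<open>1 / b\<close> the total
    is \<open>1 / (b\<^sup>2 * sqrt b)\<close>.\<close>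
  then have "has_bochner_integral lborel (\<lambda>t. g (0 + b * t) * (1 / (b * sqrt b)))
      ((Gamma (5/2) /\<^sub>R \<bar>b\<bar>) * (1 / (b * sqrt b)))"
    by (rule has_bochner_integral_mult_left)
  also have "(\<lambda>t. g (0 + b * t) * (1 / (b * sqrt b))) =
      (\<lambda>t. indicator {0<..} t * (t\<^sup>2 * exp (- b * t) / sqrt t))"
  proof
    fix t :: real
    consider "t < 0" | "t = 0" | "t > 0" by linarith
    then show "g (0 + b * t) * (1 / (b * sqrt b)) = indicator {0<..} t * (t\<^sup>2 * exp (- b * t) / sqrt t)"
    proof cases
      case 1
      then have "b * t < 0" using assms by (simp add: mult_pos_neg)
      then show ?thesis using 1 by (simp add: g_def)
    next
      case 2
      then show ?thesis by (simp add: g_def)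
    next
      case 3
      have bt: "b * t > 0" using 3 assms by simp
      have "(b * t) powr (5/2 - 1) = (b * t) powr (1 + 1/2)" by simp
      also have "\<dots> = b * t * sqrt (b * t)"
        unfolding powr_add using bt by (simp add: powr_half_sqrt)
      finally have e: "(b * t) powr (5/2 - 1) = b * t * sqrt (b * t)" .
      have "g (0 + b * t) = (b * t) powr (5/2 - 1) / exp (b * t)"
        using bt by (simp add: g_def)
      also have "\<dots> = (b * sqrt b) * ((t * sqrt t) * exp (- b * t))"
        unfolding e by (simp add: exp_minus real_sqrt_mult divide_inverse)
      finally have "g (0 + b * t) * (1 / (b * sqrt b)) = (t * sqrt t) * exp (- b * t)"
        using assms by simp
      also have "t * sqrt t = t\<^sup>2 / sqrt t"
        using 3 by (simp add: eq_divide_eq power2_eq_square mult.assoc)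
      finally show ?thesis using 3 by simp
    qed
  qed
  also have "(Gamma (5/2) /\<^sub>R \<bar>b\<bar>) * (1 / (b * sqrt b)) = Gamma (5/2) / (b\<^sup>2 * sqrt b)"
    unfolding real_scaleR_def using assms by (simp add: power2_eq_square inverse_eq_divide)
  finally show ?thesis .
qed

text \<open>For fixed \<open>x\<close>, \<open>P\<^sup>2 * D (x / P)\<close> tends to
  \<open>c * x\<^sup>2\<close>, and the global quadratic bound on \<open>D\<close> dominates it for
  every \<open>P > 0\<close>, so the limit passes under the integral. Monotonicity of
  \<open>D\<close> provides measurability.\<close>

lemma laplace_asymptotics:
  fixes D :: "real \<Rightarrow> real" and B b c :: real
  assumes mono: "mono D" and nonneg: "\<And>e. D e \<ge> 0" and le: "\<And>e. e \<ge> 0 \<Longrightarrow> D e \<le> B * e\<^sup>2"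
    and lim: "((\<lambda>e. D e / e\<^sup>2) \<longlongrightarrow> c) (at_right 0)" and b: "b > 0"
  shows "((\<lambda>P. P\<^sup>2 * (LBINT x:{0<..}. D (x / P) * exp (- b * x) / sqrt x)) \<longlongrightarrow>
    c * (Gamma (5/2) / (b\<^sup>2 * sqrt b))) at_top"
proof -
  let ?g = "\<lambda>t::real. indicator {0<..} t * (t\<^sup>2 * exp (- b * t) / sqrt t)"
  have [measurable]: "D \<in> borel_measurable borel"
    using mono by (rule borel_measurable_mono)
  have "((\<lambda>P. \<integral>x. P\<^sup>2 * (indicator {0<..} x * (D (x / P) * exp (- b * x) / sqrt x)) \<partial>lborel) \<longlongrightarrow>
      (\<integral>x. c * ?g x \<partial>lborel)) at_top"
  proof (rule integral_dominated_convergence_at_top)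
    show "integrable lborel (\<lambda>x. B * ?g x)"
      using has_bochner_integral_Gamma_5_2[OF b]
      by (intro integrable_mult_right) (simp only: has_bochner_integral_iff)
    show "\<forall>\<^sub>F P in at_top. AE x in lborel.
        norm (P\<^sup>2 * (indicator {0<..} x * (D (x / P) * exp (- b * x) / sqrt x))) \<le> B * ?g x"
      using eventually_gt_at_top[of 0]
    proof eventually_elim
      case (elim P)
      have "norm (P\<^sup>2 * (indicator {0<..} x * (D (x / P) * exp (- b * x) / sqrt x))) \<le> B * ?g x" for x
      proof (cases "x > 0")
        case True
        have "P\<^sup>2 * D (x / P) \<le> B * x\<^sup>2"
          using le[of "x / P"] True elim by (simp add: field_simps)
        then have "(P\<^sup>2 * D (x / P)) * (exp (- b * x) / sqrt x) \<le> (B * x\<^sup>2) * (exp (- b * x) / sqrt x)"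
          using True by (intro mult_right_mono) auto
        then show ?thesis using True nonneg[of "x / P"] by (simp add: abs_mult algebra_simps)
      qed simp
      then show ?case by simp
    qed
    have "((\<lambda>P. P\<^sup>2 * (indicator {0<..} x * (D (x / P) * exp (- b * x) / sqrt x))) \<longlongrightarrow> c * ?g x) at_top" for x
    proof (cases "x > 0")
      case True
      have "filterlim (\<lambda>P. x / P) (at_right 0) at_top"
        using True by real_asymp
      from filterlim_compose[OF lim this]
      have "((\<lambda>P. D (x / P) / (x / P)\<^sup>2 * ?g x) \<longlongrightarrow> c * ?g x) at_top"
        by (intro tendsto_intros)
      moreover have "\<forall>\<^sub>F P in at_top. D (x / P) / (x / P)\<^sup>2 * ?g x =
          P\<^sup>2 * (indicator {0<..} x * (D (x / P) * exp (- b * x) / sqrt x))"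
        using eventually_gt_at_top[of 0] by eventually_elim (use True in \<open>simp add: field_simps\<close>)
      ultimately show ?thesis by (rule Lim_transform_eventually)
    qed simp
    then show "AE x in lborel. ((\<lambda>P. P\<^sup>2 * (indicator {0<..} x * (D (x / P) * exp (- b * x) / sqrt x))) \<longlongrightarrow> c * ?g x) at_top"
      by simp
  qed measurable
  then show ?thesis
    by (simp only: set_lebesgue_integral_def real_scaleR_def integral_mult_right_zero
      has_bochner_integral_integral_eq[OF has_bochner_integral_Gamma_5_2[OF b]])
qed

section \<open>Asymptotics at one terminal and the sum over both\<close>

lemma par_scale: "par (P * u) (P * v) = P * par u v"
proof (cases "P = 0")
  case False
  have "par (P * u) (P * v) = (P * P * (u * v)) / (P * (u + v))"
    by (simp add: par_def algebra_simps)
  then show ?thesis using False by (simp add: par_def)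
qed (simp add: par_def)

text \<open>By Cauchy-Schwarz the squared sum is at most \<open>card I\<close> times the sum of
  squares.\<close>

lemma integrable_sum_squared:
  fixes f :: "'i \<Rightarrow> 'a \<Rightarrow> real"
  assumes meas: "\<And>i. i \<in> I \<Longrightarrow> f i \<in> borel_measurable M"
    and int: "\<And>i. i \<in> I \<Longrightarrow> integrable M (\<lambda>w. (f i w)\<^sup>2)"
  shows "integrable M (\<lambda>w. (\<Sum>i\<in>I. f i w)\<^sup>2)"
proof (rule Bochner_Integration.integrable_bound)
  show "integrable M (\<lambda>w. (\<Sum>i\<in>I. (f i w)\<^sup>2) * card I)"
    using int by auto
  show "(\<lambda>w. (\<Sum>i\<in>I. f i w)\<^sup>2) \<in> borel_measurable M"
    using meas by (intro borel_measurable_power borel_measurable_sum)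
  show "AE w in M. norm ((\<Sum>i\<in>I. f i w)\<^sup>2) \<le> norm ((\<Sum>i\<in>I. (f i w)\<^sup>2) * card I)"
    using sum_squared_le_sum_of_squares[of _ I] by (auto simp: sum_nonneg)
qed

text \<open>Homogeneity of \<open>par\<close> pulls \<open>P\<close> out of the SINR, so its
  distribution function at \<open>\<gamma>\<close> is \<open>D (\<gamma> / P)\<close> with
  \<open>D\<close> free of \<open>P\<close>. High power thus becomes small threshold, and
  \<open>outage_asymptotics\<close> feeds \<open>laplace_asymptotics\<close>.\<close>

lemma (in prob_space) terminal_ber_asymptotics:
  fixes X :: "rv_idx \<Rightarrow> 'a \<Rightarrow> complex" and Om wt :: "nat \<Rightarrow> real"
    and L :: "node \<Rightarrow> nat" and PI :: "node \<Rightarrow> real" and OmC :: "node \<Rightarrow> nat \<Rightarrow> real"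
  assumes Om: "\<And>l. l \<in> {0, 1, 2} \<Longrightarrow> Om l > 0" and PI: "\<And>N. PI N > 0"
    and OmC: "\<And>N k. 1 \<le> k \<Longrightarrow> k \<le> L N \<Longrightarrow> OmC N k > 0"
    and H: "\<And>l. l \<in> {0, 1, 2} \<Longrightarrow> distributed M lborel (X (H l)) (CN_density (Om l))"
    and C: "\<And>N k. 1 \<le> k \<Longrightarrow> k \<le> L N \<Longrightarrow> distributed M lborel (X (C N k)) (CN_density (OmC N k))"
    and ind: "indep_vars (\<lambda>_. borel) X (valid_idx L)"
    and wt: "wt i > 0" "wt (other i) > 0" and b: "b > 0" and i: "i \<in> {1, 2}"
  defines "G1 \<equiv> \<lambda>N. expectation (interf L PI X N)"
    and "m \<equiv> expectation (\<lambda>w. (interf L PI X (term_node i) w)\<^sup>2) + 2 * expectation (interf L PI X (term_node i)) + 1"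
  defines "K \<equiv> (1 / Om 0) * ((1 / Om i) * m +
      (1 / Om (other i)) * (wt i * m + (G1 R + 1) * (G1 (term_node i) + 1)) / wt (other i))"
  shows "((\<lambda>P. P\<^sup>2 * (LBINT \<gamma>:{0<..}. prob {w \<in> space M. sinr L PI X wt P i w < \<gamma>} *
      exp (- b * \<gamma>) / sqrt \<gamma>)) \<longlongrightarrow> K / 2 * (Gamma (5/2) / (b\<^sup>2 * sqrt b))) at_top"
    and "K > 0"
proof -
  let ?T = "term_node i" and ?j = "other i"
  have j: "?j \<in> {0, 1, 2}" "i \<in> {0, 1, 2}" "i \<noteq> ?j" "i \<noteq> 0" "?j \<noteq> 0" and T: "?T \<noteq> R"
    using i by (auto simp: other_def term_node_def)
  \<comment> \<open>\<open>Kx k\<close> is the block of indices that \<open>F k\<close> reads; the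
    five blocks are disjoint, so the real variables \<open>V k\<close> inherit independence from
    \<open>X\<close>. The last branch also catches \<open>k > 4\<close>, which keeps
    \<open>V k\<close> nonnegative for every \<open>k\<close>.\<close>
  define Kx where "Kx = (\<lambda>k::nat. if k = 0 then {H 0} else if k = 1 then {H i} else if k = 2 then {H ?j}
    else if k = 3 then C ?T ` {1..L ?T} else C R ` {1..L R})"
  define F :: "nat \<Rightarrow> (rv_idx \<Rightarrow> complex) \<Rightarrow> real" where
    "F = (\<lambda>k f. if k = 0 then (cmod (f (H 0)))\<^sup>2 else if k = 1 then (cmod (f (H i)))\<^sup>2
      else if k = 2 then (cmod (f (H ?j)))\<^sup>2
      else if k = 3 then (\<Sum>n = 1..L ?T. PI ?T * (cmod (f (C ?T n)))\<^sup>2)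
      else (\<Sum>n = 1..L R. PI R * (cmod (f (C R n)))\<^sup>2))"
  define V where "V k w = F k (\<lambda>x. X x w)" for k w
  have V: "V 0 = (\<lambda>w. (cmod (X (H 0) w))\<^sup>2)" "V 1 = (\<lambda>w. (cmod (X (H i) w))\<^sup>2)"
    "V 2 = (\<lambda>w. (cmod (X (H ?j) w))\<^sup>2)" "V 3 = interf L PI X ?T" "V 4 = interf L PI X R"
    by (auto simp: V_def F_def interf_def fun_eq_iff)
  have indV: "indep_vars (\<lambda>_. borel) V {..<5}"
  proof -
    have "indep_vars (\<lambda>k. PiM (Kx k) (\<lambda>_. borel)) (\<lambda>k w. restrict (\<lambda>x. X x w) (Kx k)) {..<5}"
    proof (rule indep_vars_restrict[OF ind])
      show "Kx k \<subseteq> valid_idx L" if "k \<in> {..<5}" for k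
        using j by (auto simp: Kx_def valid_idx_def)
      show "disjoint_family_on Kx {..<5}"
        using j T by (auto simp: disjoint_family_on_def Kx_def split: if_splits)
    qed
    then have "indep_vars (\<lambda>_. borel) (\<lambda>k w. F k (restrict (\<lambda>x. X x w) (Kx k))) {..<5}"
    proof (rule indep_vars_compose2)
      show "F k \<in> PiM (Kx k) (\<lambda>_. borel) \<rightarrow>\<^sub>M borel" if "k \<in> {..<5}" for k
      proof -
        show ?thesis
          unfolding F_def by (auto simp: Kx_def intro!: borel_measurable_sum borel_measurable_times
            borel_measurable_power borel_measurable_norm measurable_component_singleton)
      qed
    qed
    moreover have "F k (restrict (\<lambda>x. X x w) (Kx k)) = V k w" for k w
      by (auto simp: F_def Kx_def V_def intro!: sum.cong)
    ultimately show ?thesis by simp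
  qed
  have exps: "distributed M lborel (V 0) (exponential_density (1 / Om 0))"
    "distributed M lborel (V 1) (exponential_density (1 / Om i))"
    "distributed M lborel (V 2) (exponential_density (1 / Om ?j))"
    unfolding V using j by (auto intro!: exponential_cmod_squared H Om)
  have Om_pos: "1 / Om 0 > 0" "1 / Om i > 0" "1 / Om ?j > 0"
    using Om j by auto
  have V_nonneg: "V k w \<ge> 0" for k w
    using PI[THEN less_imp_le] by (auto simp: V_def F_def intro!: sum_nonneg mult_nonneg_nonneg)
  have moment: "integrable M (\<lambda>w. PI N * (cmod (X (C N k) w))\<^sup>2)"
      "integrable M (\<lambda>w. (PI N * (cmod (X (C N k) w))\<^sup>2)\<^sup>2)" if "1 \<le> k" "k \<le> L N" for N k
  proof -
    have p: "1 / OmC N k > 0" using OmC[OF that] by simp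
    note mom = erlang_ith_moment_integrable[OF p exponential_cmod_squared[OF C[OF that] OmC[OF that]]]
    show "integrable M (\<lambda>w. PI N * (cmod (X (C N k) w))\<^sup>2)"
      using mom[of 1] by simp
    show "integrable M (\<lambda>w. (PI N * (cmod (X (C N k) w))\<^sup>2)\<^sup>2)"
      using mom[of 2] by (simp add: power_mult_distrib)
  qed
  have int: "integrable M (interf L PI X N)" "integrable M (\<lambda>w. (interf L PI X N w)\<^sup>2)" for N
  proof -
    show "integrable M (interf L PI X N)"
      unfolding interf_def[abs_def] by (intro Bochner_Integration.integrable_sum moment) auto
    show "integrable M (\<lambda>w. (interf L PI X N w)\<^sup>2)"
      unfolding interf_def[abs_def]
      by (intro integrable_sum_squared borel_measurable_integrable moment) auto
  qed
  define S where "S w = V 3 w + 1" for w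
  \<comment> \<open>In \<open>sinr\<close> the fraction \<open>wt ?j\<close> multiplies the gain of
    the second hop; moved into the divisor, it leaves the plain exponential variable
    \<open>V 2\<close> on top.\<close>
  define Q where "Q w = (V 4 w + wt i * V 3 w + wt i + 1) / wt ?j" for w
  define D where "D e = prob {w \<in> space M. V 0 w / S w + par (V 1 w / S w) (V 2 w / Q w) < e}" for e
  have K: "K = (1 / Om 0) * ((1 / Om i) * (expectation (\<lambda>w. (V 3 w)\<^sup>2) + 2 * expectation (V 3) + 1) +
      (1 / Om ?j) * (wt i * (expectation (\<lambda>w. (V 3 w)\<^sup>2) + 2 * expectation (V 3) + 1) +
        (expectation (V 4) + 1) * (expectation (V 3) + 1)) / wt ?j)"
    unfolding K_def m_def G1_def V ..
  have intV: "integrable M (V 3)" "integrable M (\<lambda>w. (V 3 w)\<^sup>2)" "integrable M (V 4)"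
    unfolding V by (fact int)+
  note outage = outage_asymptotics[OF indV exps V_nonneg Om_pos wt intV,
      folded K S_def[abs_def] Q_def[abs_def], folded S_def Q_def, folded D_def[abs_def] D_def]
  show "K > 0" by (rule outage(3))
  have sinr: "sinr L PI X wt P i w = P * (V 0 w / S w + par (V 1 w / S w) (V 2 w / Q w))" for P w
  proof -
    have "sinr L PI X wt P i w = P * (V 0 w / S w) + par (P * (V 1 w / S w)) (P * (V 2 w / Q w))"
      unfolding sinr_def Let_def S_def Q_def V par_def by (simp add: ac_simps)
    then show ?thesis by (simp only: par_scale distrib_left)
  qed
  have D: "prob {w \<in> space M. sinr L PI X wt P i w < \<gamma>} = D (\<gamma> / P)" if "P > 0" for P \<gamma>
    unfolding D_def sinr using that by (simp add: pos_less_divide_eq mult.commute)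
  have V_rv: "V k \<in> borel_measurable M" if "k < 5" for k
    using indV that by (auto simp: indep_vars_def)
  have "mono D"
  proof (intro monoI)
    fix x y :: real assume "x \<le> y"
    have [measurable]: "V 0 \<in> borel_measurable M" "V 1 \<in> borel_measurable M" "V 2 \<in> borel_measurable M"
      "V 3 \<in> borel_measurable M" "V 4 \<in> borel_measurable M"
      using V_rv by auto
    show "D x \<le> D y"
      unfolding D_def
    proof (rule finite_measure_mono)
      show "{w \<in> space M. V 0 w / S w + par (V 1 w / S w) (V 2 w / Q w) < x} \<subseteq>
          {w \<in> space M. V 0 w / S w + par (V 1 w / S w) (V 2 w / Q w) < y}"
        using less_le_trans[OF _ \<open>x \<le> y\<close>] by blast
      show "{w \<in> space M. V 0 w / S w + par (V 1 w / S w) (V 2 w / Q w) < y} \<in> sets M"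
        unfolding S_def Q_def by measurable
    qed
  qed
  moreover have "D e \<ge> 0" for e
    by (simp add: D_def)
  ultimately have "((\<lambda>P. P\<^sup>2 * (LBINT x:{0<..}. D (x / P) * exp (- b * x) / sqrt x)) \<longlongrightarrow>
      K / 2 * (Gamma (5/2) / (b\<^sup>2 * sqrt b))) at_top"
    using outage(2,1) b by (rule laplace_asymptotics)
  moreover have "\<forall>\<^sub>F P in at_top. P\<^sup>2 * (LBINT x:{0<..}. D (x / P) * exp (- b * x) / sqrt x) =
      P\<^sup>2 * (LBINT \<gamma>:{0<..}. prob {w \<in> space M. sinr L PI X wt P i w < \<gamma>} * exp (- b * \<gamma>) / sqrt \<gamma>)"
    using eventually_gt_at_top[of 0] by eventually_elim (simp add: D)
  ultimately show "((\<lambda>P. P\<^sup>2 * (LBINT \<gamma>:{0<..}. prob {w \<in> space M. sinr L PI X wt P i w < \<gamma>} *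
      exp (- b * \<gamma>) / sqrt \<gamma>)) \<longlongrightarrow> K / 2 * (Gamma (5/2) / (b\<^sup>2 * sqrt b))) at_top"
    by (rule Lim_transform_eventually)
qed

theorem theorem5:
  fixes M :: "'a measure" and X :: "rv_idx \<Rightarrow> 'a \<Rightarrow> complex"
    and Om :: "nat \<Rightarrow> real" and L :: "node \<Rightarrow> nat" and PI :: "node \<Rightarrow> real"
    and OmC :: "node \<Rightarrow> nat \<Rightarrow> real" and wt :: "nat \<Rightarrow> real"
    and a b gth :: real
  assumes "prob_space M"
    and "\<forall>l\<in>{0,1,2}. Om l > 0"
    and "\<forall>N. L N \<ge> 1" and "\<forall>N. PI N > 0"
    and "\<forall>N k. 1 \<le> k \<and> k \<le> L N \<longrightarrow> OmC N k > 0"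
    and "\<forall>l\<in>{0,1,2}. distributed M lborel (X (H l)) (CN_density (Om l))"
    and "\<forall>N k. 1 \<le> k \<and> k \<le> L N \<longrightarrow> distributed M lborel (X (C N k)) (CN_density (OmC N k))"
    and "prob_space.indep_vars M (\<lambda>_. borel) X (valid_idx L)"
    and "0 < wt 1" and "wt 1 < 1" and "0 < wt 2" and "wt 2 < 1" and "wt 1 + wt 2 = 1"
    and "a > 0" and "b > 0" and "gth > 0"
  shows "((\<lambda>P. ber_sum M L PI X wt a b P / ber_asy M L PI X Om wt a b gth P) \<longlongrightarrow> 1) at_top"
proof -
  interpret prob_space M by fact
  define G1 where "G1 N = expectation (interf L PI X N)" for N
  define m where "m i = expectation (\<lambda>w. (interf L PI X (term_node i) w)\<^sup>2) +
    2 * expectation (interf L PI X (term_node i)) + 1" for i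
  define K where "K i = (1 / Om 0) * ((1 / Om i) * m i +
      (1 / Om (other i)) * (wt i * m i + (G1 R + 1) * (G1 (term_node i) + 1)) / wt (other i))" for i
  define I where "I P i = (LBINT \<gamma>:{0<..}. prob {w \<in> space M. sinr L PI X wt P i w < \<gamma>} *
      exp (- b * \<gamma>) / sqrt \<gamma>)" for P i
  have wt: "wt i > 0" "wt (other i) > 0" if "i \<in> {1, 2}" for i
    using that assms by (auto simp: other_def)
  have lim: "((\<lambda>P. P\<^sup>2 * I P i) \<longlongrightarrow> K i / 2 * (Gamma (5/2) / (b\<^sup>2 * sqrt b))) at_top"
    and K_pos: "K i > 0" if "i \<in> {1, 2}" for i
    using terminal_ber_asymptotics[of Om PI L OmC X wt i b] assms that wt[OF that]
    unfolding I_def K_def m_def G1_def by blast+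
  \<comment> \<open>\<open>A\<close> is both the limit of \<open>P\<^sup>2\<close> times the sum BER
    and, for each \<open>P > 0\<close>, the exact value of \<open>P\<^sup>2\<close> times the
    asymptotic expression.\<close>
  define A where "A = a / (sqrt pi * b\<^sup>2) * Gamma (5/2) * (K 1 + K 2) / 2"
  have A: "A > 0"
    unfolding A_def using K_pos[of 1] K_pos[of 2] assms
    by (intro divide_pos_pos mult_pos_pos add_pos_pos Gamma_real_pos) auto
  have "((\<lambda>P. \<Sum>i\<in>{1,2}. a * sqrt (b / pi) * (P\<^sup>2 * I P i)) \<longlongrightarrow>
      (\<Sum>i\<in>{1,2}. a * sqrt (b / pi) * (K i / 2 * (Gamma (5/2) / (b\<^sup>2 * sqrt b))))) at_top"
    by (intro tendsto_sum tendsto_mult_left lim)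
  \<comment> \<open>The factor \<open>sqrt (b / pi)\<close> cancels the \<open>sqrt b\<close> of the
    Gamma integral and leaves \<open>1 / (sqrt pi * b\<^sup>2)\<close>.\<close>
  also have "(\<Sum>i\<in>{1,2}. a * sqrt (b / pi) * (K i / 2 * (Gamma (5/2) / (b\<^sup>2 * sqrt b)))) = A"
    using assms by (simp add: A_def real_sqrt_divide field_simps)
  finally have "((\<lambda>P. (\<Sum>i\<in>{1,2}. a * sqrt (b / pi) * (P\<^sup>2 * I P i)) / A) \<longlongrightarrow> A / A) at_top"
    using A by (intro tendsto_divide tendsto_const) auto
  moreover have "\<forall>\<^sub>F P in at_top. (\<Sum>i\<in>{1,2}. a * sqrt (b / pi) * (P\<^sup>2 * I P i)) / A =
      ber_sum M L PI X wt a b P / ber_asy M L PI X Om wt a b gth P"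
    using eventually_gt_at_top[of 0]
  proof eventually_elim
    case (elim P)
    have "out_asy M L PI X Om wt gth P = (\<Sum>i\<in>{1,2}. gth\<^sup>2 * (K i / 2) / P\<^sup>2)"
      unfolding out_asy_def Let_def
    proof (rule sum.cong)
      fix i :: nat assume i: "i \<in> {1, 2}"
      then have "Om 0 > 0" "Om i > 0" "Om (other i) > 0" "wt (other i) > 0"
        using assms wt by (auto simp: other_def)
      \<comment> \<open>The moments are abstracted to \<open>x\<close> and \<open>y\<close>, so that
        the rearrangement is a pure field identity; the direct link and each bracketed term
        contribute one factor \<open>1 / P\<close> each.\<close>
      then have "gth\<^sup>2 / (2 * (P * Om 0)) * ((wt i * x + y) / (wt (other i) * (P * Om (other i))) + x / (P * Om i)) =
          gth\<^sup>2 * ((1 / Om 0) * ((1 / Om i) * x + (1 / Om (other i)) * (wt i * x + y) / wt (other i)) / 2) / P\<^sup>2" for x y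
        using elim by (simp add: field_simps power2_eq_square)
      from this show "gth\<^sup>2 / (2 * (P * Om 0)) *
           ((wt i * (expectation (\<lambda>w. (interf L PI X (term_node i) w)\<^sup>2) + 2 * expectation (interf L PI X (term_node i)) + 1)
              + (expectation (interf L PI X R) + 1) * (expectation (interf L PI X (term_node i)) + 1)) / (wt (other i) * (P * Om (other i)))
            + (expectation (\<lambda>w. (interf L PI X (term_node i) w)\<^sup>2) + 2 * expectation (interf L PI X (term_node i)) + 1) / (P * Om i)) =
          gth\<^sup>2 * (K i / 2) / P\<^sup>2"
        unfolding K_def m_def G1_def .
    qed simp
    also have "\<dots> = gth\<^sup>2 * ((K 1 + K 2) / (2 * P\<^sup>2))"
      by (simp add: add_divide_distrib distrib_left)
    \<comment> \<open>The threshold cancels here: \<open>gth\<^sup>2\<close> in the outage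
      expression meets its inverse in \<open>ber_asy\<close>.\<close>
    finally have asy: "ber_asy M L PI X Om wt a b gth P = A / P\<^sup>2"
      using \<open>gth > 0\<close> elim by (simp add: ber_asy_def A_def)
    have "ber_sum M L PI X wt a b P = (\<Sum>i\<in>{1,2}. a * sqrt (b / pi) * I P i)"
      by (simp add: ber_sum_def I_def)
    then show ?case
      using elim A by (simp add: asy field_simps)
  qed
  ultimately have "((\<lambda>P. ber_sum M L PI X wt a b P / ber_asy M L PI X Om wt a b gth P) \<longlongrightarrow> A / A) at_top"
    by (rule Lim_transform_eventually)
  then show ?thesis using A by simp
qed

end
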